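(* Fix a real number $a>1$ and $N_1,N_2\in\mathbb{N}\cup\{0\}$, and let $f\in C^2_{N_1,N_2}$. Then for every $(x,y)\in X$, $$\lim_{m\to\infty}m\bigl\{\hat{Y}_{m,m,a}(f;x,y)-f(x,y)\bigr\}=-\frac{x\log a}{2}f_x(x,y)-\frac{y\log a}{2}f_y(x,y)+\frac{x}{2}f_{xx}(x,y)+\frac{y}{2}f_{yy}(x,y).$$
   Context: $\mathbb{N}=\{1,2,3,\dots\}$ and $X=[0,\infty)\times[0,\infty)$. Subscripts on $f$ denote partial derivatives (one-sided at boundary points of $X$). Weights: $w_0(x)=1$ and $w_N(x)=(1+x^N)^{-1}$ for $N\in\mathbb{N}$, $x\ge 0$; and $w_{N_1,N_2}(x,y)=w_{N_1}(x)w_{N_2}(y)$. $C_{N_1,N_2}$ is the set of all continuous functions $f:X\to\mathbb{R}$ such that $w_{N_1,N_2}f$ is uniformly continuous and bounded on $X$. $C^2_{N_1,N_2}$ is the set of $f\in C_{N_1,N_2}$ all of whose partial derivatives of orders $1$ and $2$ exist and belong to $C_{N_1,N_2}$. Operators: for $m,n\in\mathbb{N}$ and $(x,y)\in X$, $$\hat{Y}_{m,n,a}(f;x,y)=\sum_{k_1=0}^{\infty}\sum_{k_2=0}^{\infty}a^{\frac{-x}{a^{1/m}-1}}\,a^{\frac{-y}{a^{1/n}-1}}\,\frac{x^{k_1}y^{k_2}(\log a)^{k_1+k_2}}{(a^{1/m}-1)^{k_1}(a^{1/n}-1)^{k_2}\,k_1!\,k_2!}\;f\!\left(\frac{k_1}{m},\frac{k_2}{n}\right),$$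 with the convention $0^0=1$; $\hat{Y}_{m,m,a}$ is the case $n=m$. *)

theory Defs
  imports "HOL-Analysis.Analysis"
begin

text \<open>
  Functions on the quadrant are represented by total functions on \<^typ>\<open>real \<times> real\<close>; every notion
  below only looks at their values on the quadrant.
\<close>

definition quadrant :: "(real \<times> real) set" where
  "quadrant = {0..} \<times> {0..}"

definition weight :: "nat \<Rightarrow> real \<Rightarrow> real" where
  "weight N x = (if N = 0 then 1 else inverse (1 + x ^ N))"

definition weight2 :: "nat \<Rightarrow> nat \<Rightarrow> real \<times> real \<Rightarrow> real" where
  "weight2 N1 N2 = (\<lambda>(x, y). weight N1 x * weight N2 y)"

definition C_space :: "nat \<Rightarrow> nat \<Rightarrow> (real \<times> real \<Rightarrow> real) set" where
  "C_space N1 N2 = {f. continuous_on quadrant f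
     \<and> uniformly_continuous_on quadrant (\<lambda>p. weight2 N1 N2 p * f p)
     \<and> bounded ((\<lambda>p. weight2 N1 N2 p * f p) ` quadrant)}"

text \<open>
  Differentiating within \<^term>\<open>{0..} :: real set\<close> gives the one-sided derivative at \<open>0\<close> and the
  ordinary one at positive points. The values of \<open>partial_x f\<close> and \<open>partial_y f\<close> are meaningful
  only where the derivative exists, which is what the two predicates express.
\<close>

definition has_partial_x :: "(real \<times> real \<Rightarrow> real) \<Rightarrow> bool" where
  "has_partial_x f \<longleftrightarrow>
     (\<forall>(x, y) \<in> quadrant. (\<lambda>s. f (s, y)) differentiable (at x within {0..}))"

definition has_partial_y :: "(real \<times> real \<Rightarrow> real) \<Rightarrow> bool" where
  "has_partial_y f \<longleftrightarrow>
     (\<forall>(x, y) \<in> quadrant. (\<lambda>t. f (x, t)) differentiable (at y within {0..}))"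

definition partial_x :: "(real \<times> real \<Rightarrow> real) \<Rightarrow> real \<times> real \<Rightarrow> real" where
  "partial_x f = (\<lambda>(x, y). vector_derivative (\<lambda>s. f (s, y)) (at x within {0..}))"

definition partial_y :: "(real \<times> real \<Rightarrow> real) \<Rightarrow> real \<times> real \<Rightarrow> real" where
  "partial_y f = (\<lambda>(x, y). vector_derivative (\<lambda>t. f (x, t)) (at y within {0..}))"

definition C2_space :: "nat \<Rightarrow> nat \<Rightarrow> (real \<times> real \<Rightarrow> real) set" where
  "C2_space N1 N2 = {f \<in> C_space N1 N2.
     has_partial_x f \<and> partial_x f \<in> C_space N1 N2 \<and>
     has_partial_y f \<and> partial_y f \<in> C_space N1 N2 \<and>
     has_partial_x (partial_x f) \<and> partial_x (partial_x f) \<in> C_space N1 N2 \<and>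
     has_partial_y (partial_x f) \<and> partial_y (partial_x f) \<in> C_space N1 N2 \<and>
     has_partial_x (partial_y f) \<and> partial_x (partial_y f) \<in> C_space N1 N2 \<and>
     has_partial_y (partial_y f) \<and> partial_y (partial_y f) \<in> C_space N1 N2}"

text \<open>
  Intended for \<open>m, n \<ge> 1\<close> and \<open>a > 1\<close>. For \<open>f\<close> in some \<^term>\<open>C_space N1 N2\<close> and \<open>(x, y)\<close> in the
  quadrant, both series converge absolutely, because \<open>f\<close> grows at most polynomially.
\<close>

definition Y_hat ::
    "nat \<Rightarrow> nat \<Rightarrow> real \<Rightarrow> (real \<times> real \<Rightarrow> real) \<Rightarrow> real \<times> real \<Rightarrow> real" where
  "Y_hat m n a f = (\<lambda>(x, y). \<Sum>k1. \<Sum>k2.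
     a powr (- x / (a powr (1 / real m) - 1)) * a powr (- y / (a powr (1 / real n) - 1))
     * ((x ^ k1 * y ^ k2 * ln a ^ (k1 + k2))
        / ((a powr (1 / real m) - 1) ^ k1 * (a powr (1 / real n) - 1) ^ k2 * fact k1 * fact k2))
     * f (real k1 / real m, real k2 / real n))"

end

theory Submission
  imports Defs "HOL-Real_Asymp.Real_Asymp"
begin

text \<open>
  The weights of \<^const>\<open>Y_hat\<close> are those of two independent Poisson variables \<open>K\<^sub>1, K\<^sub>2\<close> with
  parameters \<open>x \<cdot> r\<^sub>m\<close>, \<open>y \<cdot> r\<^sub>m\<close>, where \<open>r\<^sub>m = ln a / (a powr (1/m) - 1) = m - ln a / 2 + o(1)\<close>, so
  \<open>Y_hat m m a f (x, y)\<close> is the mean of \<open>f (K\<^sub>1/m, K\<^sub>2/m)\<close>. Replacing \<open>f\<close> by its second-order Taylor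
  polynomial at \<open>(x, y)\<close>, the drift \<open>r\<^sub>m - m\<close> yields the first-order terms of the limit and the
  variances yield the second-order ones. The remainder is at most \<open>e\<close> times the squared distance
  near \<open>(x, y)\<close> and \<open>O(exp (s + t))\<close> elsewhere; by a Chernoff bound with tilt \<open>\<plusminus>sqrt m\<close>, the mean of
  the latter is \<open>O(exp (- d \<cdot> sqrt m))\<close>, which is negligible even after multiplication by \<open>m\<close>.
\<close>

subsection \<open>Poisson sums\<close>

definition poisson_weight :: "real \<Rightarrow> nat \<Rightarrow> real" where
  "poisson_weight r k = exp (- r) * r ^ k / fact k"

lemma poisson_weight_nonneg: "r \<ge> 0 \<Longrightarrow> poisson_weight r k \<ge> 0"
  by (simp add: poisson_weight_def)

text \<open>This is the exponential series at \<open>r * z\<close>. Its terms are nonnegative, so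
  the ordered sum is also an unconditional \<open>has_sum\<close>, the form needed later for sums
  over pairs.\<close>

lemma poisson_generating:
  assumes "r \<ge> 0" "z \<ge> 0"
  shows "((\<lambda>k. poisson_weight r k * z ^ k) has_sum exp (r * (z - 1))) UNIV"
proof (rule sums_nonneg_imp_has_sum)
  have "(\<lambda>k. exp (- r) * ((r * z) ^ k /\<^sub>R fact k)) sums (exp (- r) * exp (r * z))"
    by (intro sums_mult exp_converges)
  then show "(\<lambda>k. poisson_weight r k * z ^ k) sums exp (r * (z - 1))"
    by (simp add: poisson_weight_def power_mult_distrib field_simps flip: exp_add)
  show "poisson_weight r k * z ^ k \<ge> 0" for k
    using assms by (simp add: poisson_weight_nonneg)
qed

lemma poisson_total: "r \<ge> 0 \<Longrightarrow> ((\<lambda>k. poisson_weight r k) has_sum 1) UNIV"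
  using poisson_generating[of r 1] by simp

text \<open>The index shift that reduces each moment to the preceding one; the term at
  \<open>k = 0\<close> of a moment vanishes.\<close>

lemma poisson_weight_Suc: "poisson_weight r (Suc k) * real (Suc k) = r * poisson_weight r k"
  by (simp add: poisson_weight_def del: of_nat_Suc)

lemma poisson_first_moment:
  assumes "r \<ge> 0"
  shows "((\<lambda>k. poisson_weight r k * real k) has_sum r) UNIV"
proof (rule sums_nonneg_imp_has_sum)
  have "(\<lambda>k. r * poisson_weight r k) sums (r * 1)"
    by (intro sums_mult has_sum_imp_sums poisson_total assms)
  then have "(\<lambda>k. poisson_weight r (Suc k) * real (Suc k)) sums r"
    unfolding poisson_weight_Suc by simp
  from sums_Suc[OF this] show "(\<lambda>k. poisson_weight r k * real k) sums r"
    by simp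
  show "poisson_weight r k * real k \<ge> 0" for k
    using assms by (simp add: poisson_weight_nonneg)
qed

lemma poisson_second_moment:
  assumes "r \<ge> 0"
  shows "((\<lambda>k. poisson_weight r k * (real k)\<^sup>2) has_sum (r\<^sup>2 + r)) UNIV"
proof (rule sums_nonneg_imp_has_sum)
  have "(\<lambda>k. r * (poisson_weight r k * real k + poisson_weight r k)) sums (r * (r + 1))"
    by (intro sums_mult sums_add has_sum_imp_sums poisson_total poisson_first_moment assms)
  moreover have "poisson_weight r (Suc k) * (real (Suc k))\<^sup>2
      = r * (poisson_weight r k * real k + poisson_weight r k)" for k
  proof -
    have "poisson_weight r (Suc k) * (real (Suc k))\<^sup>2
        = (poisson_weight r (Suc k) * real (Suc k)) * real (Suc k)"
      by (simp add: power2_eq_square)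
    then show ?thesis unfolding poisson_weight_Suc by (simp add: algebra_simps)
  qed
  ultimately show "(\<lambda>k. poisson_weight r k * (real k)\<^sup>2) sums (r\<^sup>2 + r)"
    using sums_Suc[of "\<lambda>k. poisson_weight r k * (real k)\<^sup>2" "r * (r + 1)"]
    by (simp add: power2_eq_square algebra_simps)
  show "poisson_weight r k * (real k)\<^sup>2 \<ge> 0" for k
    using assms by (simp add: poisson_weight_nonneg)
qed

lemma poisson_mgf:
  assumes "r \<ge> 0"
  shows "((\<lambda>k. poisson_weight r k * exp (c * (real k / real m)))
           has_sum exp (r * (exp (c / real m) - 1))) UNIV"
proof -
  have "exp (c / real m) ^ k = exp (c * (real k / real m))" for k
    by (simp add: field_simps flip: exp_of_nat_mult)
  then show ?thesis using poisson_generating[of r "exp (c / real m)"] assms by simp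
qed

lemma poisson_mean_deviation:
  assumes "r \<ge> 0"
  shows "((\<lambda>k. poisson_weight r k * (real k / real m - x)) has_sum (r / real m - x)) UNIV"
  using has_sum_add[OF has_sum_cmult_left[OF poisson_first_moment[OF assms], of "1 / real m"]
      has_sum_cmult_left[OF poisson_total[OF assms], of "- x"]]
  by (simp add: algebra_simps)

text \<open>Variance plus squared bias: \<open>K/m\<close> has variance \<open>r / m^2\<close> and
  mean \<open>r / m\<close>.\<close>

lemma poisson_mean_square_deviation:
  assumes "r \<ge> 0"
  shows "((\<lambda>k. poisson_weight r k * (real k / real m - x)\<^sup>2)
           has_sum (r / (real m)\<^sup>2 + (r / real m - x)\<^sup>2)) UNIV"
proof -
  have "((\<lambda>k. poisson_weight r k * (real k)\<^sup>2 * (1 / (real m)\<^sup>2)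
            + poisson_weight r k * real k * (- 2 * x / real m) + poisson_weight r k * x\<^sup>2)
          has_sum ((r\<^sup>2 + r) * (1 / (real m)\<^sup>2) + r * (- 2 * x / real m) + 1 * x\<^sup>2)) UNIV"
    by (intro has_sum_add has_sum_cmult_left poisson_total poisson_first_moment
        poisson_second_moment assms)
  moreover have "poisson_weight r k * (real k)\<^sup>2 * (1 / (real m)\<^sup>2)
            + poisson_weight r k * real k * (- 2 * x / real m) + poisson_weight r k * x\<^sup>2
          = poisson_weight r k * (real k / real m - x)\<^sup>2" for k
    by (simp add: power2_diff power_divide algebra_simps)
  moreover have "(r\<^sup>2 + r) * (1 / (real m)\<^sup>2) + r * (- 2 * x / real m) + 1 * x\<^sup>2
          = r / (real m)\<^sup>2 + (r / real m - x)\<^sup>2"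
    by (simp add: power2_diff power_divide add_divide_distrib)
  ultimately show ?thesis by simp
qed

section \<open>Asymptotics of the Poisson parameter and of the tilted moments\<close>

definition rate :: "real \<Rightarrow> nat \<Rightarrow> real" where
  "rate a m = ln a / (a powr (1 / real m) - 1)"

lemma rate_exp: "a > 1 \<Longrightarrow> rate a m = ln a / (exp (ln a / real m) - 1)"
  by (simp add: rate_def powr_def)

lemma rate_div_tendsto:
  assumes "a > 1"
  shows "(\<lambda>m. rate a m / real m) \<longlonglongrightarrow> 1"
proof -
  have "ln a > 0" using assms by simp
  then show ?thesis unfolding rate_exp[OF assms] by real_asymp
qed

lemma rate_deviation_tendsto:
  assumes "a > 1"
  shows "(\<lambda>m. real m * (z * rate a m / real m - z)) \<longlonglongrightarrow> - (z * ln a / 2)"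
proof -
  have "ln a > 0" using assms by simp
  \<comment> \<open>The factor \<open>z\<close>, whose sign is not fixed, is split off so that the
    asymptotic expansion involves only \<open>ln a > 0\<close>.\<close>
  then have "(\<lambda>m. real m * (rate a m / real m - 1)) \<longlonglongrightarrow> - (ln a / 2)"
    unfolding rate_exp[OF assms] by real_asymp (simp add: field_simps)
  from tendsto_mult_left[OF this, of z]
  have "(\<lambda>m. z * (real m * (rate a m / real m - 1))) \<longlonglongrightarrow> - (z * ln a / 2)"
    by simp
  moreover have "real m * (z * S / real m - z) = z * (real m * (S / real m - 1))" for m S
    by (simp add: right_diff_distrib)
  ultimately show ?thesis by (simp only:)
qed

lemma rate_square_deviation_tendsto:
  assumes "a > 1"
  shows "(\<lambda>m. real m * (z * rate a m / (real m)\<^sup>2 + (z * rate a m / real m - z)\<^sup>2)) \<longlonglongrightarrow> z"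
proof -
  \<comment> \<open>Of the two factors of the squared bias only one absorbs \<open>m\<close> and
    stays bounded; the other tends to 0, so only the variance survives.\<close>
  have "(\<lambda>m. z * (rate a m / real m)
      + real m * (z * rate a m / real m - z) * (z * (rate a m / real m) - z))
      \<longlonglongrightarrow> z * 1 + - (z * ln a / 2) * (z * 1 - z)"
    by (intro tendsto_intros rate_div_tendsto rate_deviation_tendsto assms)
  moreover have "z * (S / real m) + real m * (z * S / real m - z) * (z * (S / real m) - z)
      = real m * (z * S / (real m)\<^sup>2 + (z * S / real m - z)\<^sup>2)" for S m
    by (simp add: power2_eq_square distrib_left)
  ultimately show ?thesis by simp
qed

text \<open>
  The mean of \<open>exp (n * (K/m - x)) * exp (K/m)\<close> for \<open>K\<close> Poisson with parameter \<open>r\<close>; the second factor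
  accounts for the exponential growth bound on \<open>f\<close>.
\<close>

definition tilted_mgf :: "nat \<Rightarrow> real \<Rightarrow> real \<Rightarrow> real \<Rightarrow> real" where
  "tilted_mgf m r x n = exp (- (n * x)) * exp (r * (exp ((1 + n) / real m) - 1))"

lemma tilted_mgf_rate:
  "tilted_mgf m (z * rate a m) z n = exp (z * (rate a m * (exp ((1 + n) / real m) - 1) - n))"
  by (simp add: tilted_mgf_def algebra_simps flip: exp_add)

text \<open>With tilt \<open>n\<close>, the exponent divided by \<open>z\<close> is
  \<open>1 + n^2 / (2 m) + o(1)\<close> for \<open>n = 0\<close> and
  \<open>n = \<plusminus>sqrt m\<close>. The 1 comes from the growth factor
  \<open>exp (K/m)\<close>, and \<open>n^2 = m\<close> adds 1/2. A tilt of order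
  \<open>sqrt m\<close> thus keeps the moments bounded.\<close>

lemma tilted_mgf_tendsto:
  assumes "a > 1"
  shows "(\<lambda>m. tilted_mgf m (z * rate a m) z 0) \<longlonglongrightarrow> exp (z * 1)"
    and "(\<lambda>m. tilted_mgf m (z * rate a m) z (sqrt (real m))) \<longlonglongrightarrow> exp (z * (3 / 2))"
    and "(\<lambda>m. tilted_mgf m (z * rate a m) z (- sqrt (real m))) \<longlonglongrightarrow> exp (z * (3 / 2))"
proof -
  have L: "ln a > 0" using assms by simp
  show "(\<lambda>m. tilted_mgf m (z * rate a m) z 0) \<longlonglongrightarrow> exp (z * 1)"
    unfolding tilted_mgf_rate
  proof (intro tendsto_exp tendsto_mult_left)
    show "(\<lambda>m. rate a m * (exp ((1 + 0) / real m) - 1) - 0) \<longlonglongrightarrow> 1"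
      using L unfolding rate_exp[OF assms] by real_asymp
  qed
  show "(\<lambda>m. tilted_mgf m (z * rate a m) z (sqrt (real m))) \<longlonglongrightarrow> exp (z * (3 / 2))"
    unfolding tilted_mgf_rate
  proof (intro tendsto_exp tendsto_mult_left)
    show "(\<lambda>m. rate a m * (exp ((1 + sqrt (real m)) / real m) - 1) - sqrt (real m)) \<longlonglongrightarrow> 3 / 2"
      using L unfolding rate_exp[OF assms] by real_asymp
  qed
  show "(\<lambda>m. tilted_mgf m (z * rate a m) z (- sqrt (real m))) \<longlonglongrightarrow> exp (z * (3 / 2))"
    unfolding tilted_mgf_rate
  proof (intro tendsto_exp tendsto_mult_left)
    show "(\<lambda>m. rate a m * (exp ((1 + - sqrt (real m)) / real m) - 1) - - sqrt (real m)) \<longlonglongrightarrow> 3 / 2"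
      using L unfolding rate_exp[OF assms] by real_asymp
  qed
qed

lemma mult_exp_minus_sqrt_tendsto:
  "d > (0::real) \<Longrightarrow> (\<lambda>m. real m * exp (- (sqrt (real m) * d))) \<longlonglongrightarrow> 0"
  by real_asymp

section \<open>Means over two independent Poisson variables\<close>

text \<open>For real families unconditional and absolute summability coincide, so the product family
  is absolutely summable and may be summed row by row.\<close>

lemma has_sum_product:
  fixes g :: "'a \<Rightarrow> real" and h :: "'b \<Rightarrow> real"
  assumes g: "(g has_sum a) A" and h: "(h has_sum b) B"
  shows "((\<lambda>p. g (fst p) * h (snd p)) has_sum (a * b)) (A \<times> B)"
proof (rule has_sum_SigmaI[where g = "\<lambda>i. g i * b"])
  have "(\<lambda>i. \<bar>g i\<bar>) summable_on A" "(\<lambda>j. \<bar>h j\<bar>) summable_on B"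
    using g h summable_on_iff_abs_summable_on_real by (fastforce simp: summable_on_def)+
  then obtain a' b' where "((\<lambda>i. \<bar>g i\<bar>) has_sum a') A" "((\<lambda>j. \<bar>h j\<bar>) has_sum b') B"
    by (auto simp: summable_on_def)
  then have "(\<lambda>p. \<bar>g (fst p)\<bar> * \<bar>h (snd p)\<bar>) summable_on (A \<times> B)"
    by (intro summable_on_SigmaI[where g = "\<lambda>i. \<bar>g i\<bar> * b'"] summable_on_cmult_left)
       (auto intro: has_sum_cmult_right simp: summable_on_def)
  then show "(\<lambda>p. g (fst p) * h (snd p)) summable_on (A \<times> B)"
    by (subst summable_on_iff_abs_summable_on_real) (simp add: abs_mult)
qed (use assms in \<open>auto intro: has_sum_cmult_right has_sum_cmult_left\<close>)

text \<open>A relation rather than a value: each instance carries the existence of the mean, so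
  linearity and monotonicity can be chained without separate summability conditions.\<close>

definition poisson2_mean ::
    "nat \<Rightarrow> real \<Rightarrow> real \<Rightarrow> (real \<Rightarrow> real \<Rightarrow> real) \<Rightarrow> real \<Rightarrow> bool" where
  "poisson2_mean m r q G E \<longleftrightarrow>
     ((\<lambda>p. poisson_weight r (fst p) * poisson_weight q (snd p)
          * G (real (fst p) / real m) (real (snd p) / real m)) has_sum E) UNIV"

lemma poisson2_mean_product:
  assumes "((\<lambda>k. poisson_weight r k * g (real k / real m)) has_sum a) UNIV"
    and "((\<lambda>k. poisson_weight q k * h (real k / real m)) has_sum b) UNIV"
  shows "poisson2_mean m r q (\<lambda>s t. g s * h t) (a * b)"
  using has_sum_product[OF assms] unfolding poisson2_mean_def by (simp add: mult_ac)

lemma poisson2_mean_fst: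
  assumes "q \<ge> 0" "((\<lambda>k. poisson_weight r k * g (real k / real m)) has_sum a) UNIV"
  shows "poisson2_mean m r q (\<lambda>s t. g s) a"
  using poisson2_mean_product[of r g m a q "\<lambda>_. 1" 1] assms poisson_total by simp

lemma poisson2_mean_snd:
  assumes "r \<ge> 0" "((\<lambda>k. poisson_weight q k * h (real k / real m)) has_sum b) UNIV"
  shows "poisson2_mean m r q (\<lambda>s t. h t) b"
  using poisson2_mean_product[of r "\<lambda>_. 1" m 1 q h b] assms poisson_total by simp

lemma poisson2_mean_const:
  assumes "r \<ge> 0" "q \<ge> 0"
  shows "poisson2_mean m r q (\<lambda>s t. c) c"
  using poisson2_mean_fst[of q r "\<lambda>_. c" m c] assms
    has_sum_cmult_left[OF poisson_total, of r c] by simp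

lemma poisson2_mean_add:
  assumes "poisson2_mean m r q G E" "poisson2_mean m r q H F"
  shows "poisson2_mean m r q (\<lambda>s t. G s t + H s t) (E + F)"
  using has_sum_add[OF assms[unfolded poisson2_mean_def]]
  unfolding poisson2_mean_def by (simp add: distrib_left)

lemma poisson2_mean_cmult:
  assumes "poisson2_mean m r q G E"
  shows "poisson2_mean m r q (\<lambda>s t. c * G s t) (c * E)"
  using has_sum_cmult_right[OF assms[unfolded poisson2_mean_def], of c]
  unfolding poisson2_mean_def by (simp add: mult_ac)

lemma poisson2_mean_mono:
  assumes "r \<ge> 0" "q \<ge> 0" "poisson2_mean m r q G E" "poisson2_mean m r q H F"
    and "\<And>s t. s \<ge> 0 \<Longrightarrow> t \<ge> 0 \<Longrightarrow> G s t \<le> H s t"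
  shows "E \<le> F"
  using assms(3,4) unfolding poisson2_mean_def
  by (rule has_sum_mono) (intro mult_left_mono assms, auto simp: assms poisson_weight_nonneg)

lemma poisson2_mean_abs_diff_le:
  assumes "r \<ge> 0" "q \<ge> 0" "poisson2_mean m r q G E" "poisson2_mean m r q H F"
    and "poisson2_mean m r q K B"
    and "\<And>s t. s \<ge> 0 \<Longrightarrow> t \<ge> 0 \<Longrightarrow> \<bar>G s t - H s t\<bar> \<le> K s t"
  shows "\<bar>E - F\<bar> \<le> B"
proof -
  have "G s t \<le> H s t + K s t" "H s t \<le> G s t + K s t" if "s \<ge> 0" "t \<ge> 0" for s t
    using assms(6)[OF that] by linarith+
  then have "E \<le> F + B" "F \<le> E + B"
    using poisson2_mean_mono[OF assms(1-3) poisson2_mean_add[OF assms(4,5)]]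
      poisson2_mean_mono[OF assms(1,2,4) poisson2_mean_add[OF assms(3,5)]] by blast+
  then show ?thesis by linarith
qed

text \<open>Supplies the existence of the mean of \<open>f\<close> itself, about which only a growth
  bound is known.\<close>

lemma poisson2_mean_dominated:
  assumes "r \<ge> 0" "q \<ge> 0" "poisson2_mean m r q H F"
    and "\<And>s t. s \<ge> 0 \<Longrightarrow> t \<ge> 0 \<Longrightarrow> \<bar>G s t\<bar> \<le> H s t"
  shows "\<exists>E. poisson2_mean m r q G E"
proof -
  have "(\<lambda>p. norm (poisson_weight r (fst p) * poisson_weight q (snd p)
      * G (real (fst p) / real m) (real (snd p) / real m))) summable_on UNIV"
    by (rule Infinite_Sum.abs_summable_on_comparison_test')
       (use assms(3) in \<open>auto simp: poisson2_mean_def summable_on_def abs_mult assms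
          poisson_weight_nonneg intro!: mult_left_mono\<close>)
  then show ?thesis
    unfolding poisson2_mean_def using abs_summable_summable summable_on_def by blast
qed

text \<open>Fubini, leading from sums over pairs to the nested series in \<open>Y_hat\<close>. Since
  \<open>suminf\<close> says nothing about convergence, summability of every row and of the row sums
  has to be established first.\<close>

lemma has_sum_imp_iterated_suminf:
  fixes F :: "nat \<times> nat \<Rightarrow> real"
  assumes "(F has_sum E) UNIV"
  shows "(\<Sum>i. \<Sum>j. F (i, j)) = E"
proof -
  have F: "F summable_on Sigma UNIV (\<lambda>_. UNIV)"
    using assms by (auto simp: summable_on_def)
  have eq: "(\<Sum>j. F (i, j)) = infsum (\<lambda>j. F (i, j)) UNIV" for i
  proof -
    have "(\<lambda>j. F (i, j)) summable_on UNIV"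
      by (rule summable_on_SigmaD1[where A = UNIV]) (use F in auto)
    then show ?thesis
      by (metis has_sum_infsum has_sum_imp_sums sums_unique)
  qed
  have "(\<lambda>i. infsum (\<lambda>j. F (i, j)) UNIV) summable_on UNIV"
    by (rule summable_on_Sigma_banach) (use F in auto)
  then have "(\<Sum>i. infsum (\<lambda>j. F (i, j)) UNIV) = infsum (\<lambda>i. infsum (\<lambda>j. F (i, j)) UNIV) UNIV"
    by (metis has_sum_infsum has_sum_imp_sums sums_unique)
  also have "\<dots> = infsum F UNIV"
    using infsum_Sigma_banach[OF F] by simp
  finally show ?thesis
    using assms by (simp add: eq infsumI)
qed

lemma Y_hat_eq_poisson2_mean:
  assumes "a > 1"
    and "poisson2_mean m (x * rate a m) (y * rate a m) (\<lambda>s t. f (s, t)) E"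
  shows "Y_hat m m a f (x, y) = E"
proof -
  define d where "d = a powr (1 / real m) - 1"
  define s where "s = rate a m"
  have "a powr (- x / d) * a powr (- y / d)
     * ((x ^ i * y ^ j * ln a ^ (i + j)) / (d ^ i * d ^ j * fact i * fact j))
     = poisson_weight (x * s) i * poisson_weight (y * s) j" for i j
  proof -
    have s: "s = ln a / d"
      by (simp add: d_def s_def rate_def)
    have "a powr (- x / d) = exp (- (x * s))" "a powr (- y / d) = exp (- (y * s))"
      using assms(1) by (simp_all add: powr_def s)
    then show ?thesis
      by (simp add: poisson_weight_def s power_add power_mult_distrib power_divide mult_ac)
  qed
  then show ?thesis
    using has_sum_imp_iterated_suminf[OF assms(2)[unfolded poisson2_mean_def]]
    unfolding Y_hat_def d_def s_def by (simp only: prod.case fst_conv snd_conv)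
qed

subsection \<open>Taylor remainders on the quadrant\<close>

text \<open>The mean value inequality is applied twice, to \<open>g' u - c * u\<close> and then to
  \<open>g\<close> minus its quadratic part. The number \<open>c\<close> need not be
  \<open>g'' x\<close>: below, it is a second derivative at a point off the line on which
  \<open>g\<close> lives. The crude estimate by \<open>\<bar>s - x\<bar>\<close> in the first round
  is why the constant is \<open>e\<close> and not \<open>e / 2\<close>.\<close>

lemma second_order_remainder:
  fixes g g' g'' :: "real \<Rightarrow> real"
  assumes "convex S" "x \<in> S" "s \<in> S"
    and g: "\<And>u. u \<in> S \<Longrightarrow> (g has_field_derivative g' u) (at u within S)"
    and g': "\<And>u. u \<in> S \<Longrightarrow> (g' has_field_derivative g'' u) (at u within S)"
    and bound: "\<And>u. u \<in> closed_segment x s \<Longrightarrow> \<bar>g'' u - c\<bar> \<le> e"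
  shows "\<bar>g s - g x - g' x * (s - x) - c / 2 * (s - x)\<^sup>2\<bar> \<le> e * (s - x)\<^sup>2"
proof -
  let ?I = "closed_segment x s"
  have sub: "?I \<subseteq> S" using assms(1-3) by (simp add: closed_segment_subset)
  have "0 \<le> e" using bound[of x] by simp
  have g'_bound: "\<bar>g' u - g' x - c * (u - x)\<bar> \<le> e * \<bar>s - x\<bar>" if "u \<in> ?I" for u
  proof -
    have "norm ((g' u - c * u) - (g' x - c * x)) \<le> e * norm (u - x)"
    proof (rule field_differentiable_bound[where S = ?I and f' = "\<lambda>u. g'' u - c"])
      fix z assume z: "z \<in> ?I"
      then have "(g' has_field_derivative g'' z) (at z within ?I)"
        using g' sub by (meson has_field_derivative_subset subsetD)
      then show "((\<lambda>u. g' u - c * u) has_field_derivative g'' z - c) (at z within ?I)"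
        by (auto intro!: derivative_eq_intros)
      show "norm (g'' z - c) \<le> e" using bound z by simp
    qed (use that in auto)
    moreover have "\<bar>u - x\<bar> \<le> \<bar>s - x\<bar>"
      using that by (auto simp: closed_segment_eq_real_ivl split: if_splits)
    ultimately show ?thesis
      using mult_left_mono[OF _ \<open>0 \<le> e\<close>, of "\<bar>u - x\<bar>" "\<bar>s - x\<bar>"] by (simp add: algebra_simps)
  qed
  let ?h = "\<lambda>u. g u - g' x * (u - x) - c / 2 * (u - x)\<^sup>2"
  have "norm (?h s - ?h x) \<le> (e * \<bar>s - x\<bar>) * norm (s - x)"
  proof (rule field_differentiable_bound[where S = ?I and f' = "\<lambda>u. g' u - g' x - c * (u - x)"])
    fix z assume z: "z \<in> ?I"
    then have "(g has_field_derivative g' z) (at z within ?I)"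
      using g sub by (meson has_field_derivative_subset subsetD)
    then show "(?h has_field_derivative g' z - g' x - c * (z - x)) (at z within ?I)"
      by (auto intro!: derivative_eq_intros)
    show "norm (g' z - g' x - c * (z - x)) \<le> e * \<bar>s - x\<bar>"
      using g'_bound z by simp
  qed auto
  then show ?thesis by (simp add: power2_eq_square mult.assoc algebra_simps)
qed

section \<open>Exponential growth bounds from the weights\<close>

lemma power_le_fact_exp:
  assumes "(s::real) \<ge> 0"
  shows "s ^ n \<le> fact n * exp s"
proof -
  \<comment> \<open>A single term of a series with nonnegative terms is at most the whole
    series.\<close>
  have "(\<Sum>k\<in>{n}. s ^ k /\<^sub>R fact k) \<le> (\<Sum>k. s ^ k /\<^sub>R fact k)"
    using exp_converges[of s] assms by (intro sum_le_suminf) (auto simp: sums_iff)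
  then show ?thesis
    by (simp add: exp_def field_simps)
qed

lemma weight_pos: "s \<ge> 0 \<Longrightarrow> weight N s > 0"
  by (simp add: weight_def add_pos_nonneg)

lemma weight_exp_ge_1:
  assumes "s \<ge> 0"
  shows "1 \<le> weight N s * ((1 + fact N) * exp s)"
proof (cases "N = 0")
  \<comment> \<open>Separate because \<open>weight 0\<close> is 1, whereas the general formula would
    give 1/2.\<close>
  case True
  have "1 \<le> exp s" using assms by simp
  with True show ?thesis by (simp add: weight_def del: one_le_exp_iff)
next
  case False
  have "1 + s ^ N \<le> (1 + fact N) * exp s"
    using power_le_fact_exp[OF assms, of N] assms by (simp add: distrib_right add_mono)
  moreover have "1 + s ^ N > 0" using assms by (simp add: add_pos_nonneg)
  ultimately show ?thesis using False by (simp add: weight_def field_simps)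
qed

text \<open>Trades the polynomial weights for one exponential that factors over the coordinates and
  whose Poisson mean has a closed form.\<close>

lemma C_space_exp_bound:
  assumes "f \<in> C_space N1 N2"
  obtains B where "B \<ge> 0" "\<And>s t. s \<ge> 0 \<Longrightarrow> t \<ge> 0 \<Longrightarrow> \<bar>f (s, t)\<bar> \<le> B * exp (s + t)"
proof -
  have "bounded ((\<lambda>p. weight2 N1 N2 p * f p) ` quadrant)"
    using assms by (simp add: C_space_def)
  then obtain M where M: "M > 0" "\<And>p. p \<in> quadrant \<Longrightarrow> \<bar>weight2 N1 N2 p * f p\<bar> \<le> M"
    by (auto simp: bounded_pos)
  let ?c = "(1 + fact N1) * (1 + fact N2) :: real"
  have "\<bar>f (s, t)\<bar> \<le> M * ?c * exp (s + t)" if "s \<ge> 0" "t \<ge> 0" for s t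
  proof -
    let ?u = "(1 + fact N1) * exp s" and ?v = "(1 + fact N2) * exp t"
    have "1 * 1 \<le> (weight N1 s * ?u) * (weight N2 t * ?v)"
      using that by (intro mult_mono weight_exp_ge_1) (auto simp: weight_pos less_imp_le)
    then have "1 * \<bar>f (s, t)\<bar> \<le> (weight N1 s * ?u) * (weight N2 t * ?v) * \<bar>f (s, t)\<bar>"
      by (intro mult_right_mono) auto
    also have "\<dots> = \<bar>weight2 N1 N2 (s, t) * f (s, t)\<bar> * (?u * ?v)"
      using that by (simp add: weight2_def abs_mult weight_pos less_imp_le)
    also have "\<dots> \<le> M * (?u * ?v)"
      using M(2)[of "(s, t)"] that by (intro mult_right_mono) (auto simp: quadrant_def)
    finally show ?thesis by (simp add: exp_add mult_ac)
  qed
  with that[of "M * ?c"] M(1) show ?thesis by simp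
qed

section \<open>Second-order expansion in two variables\<close>

lemma has_field_derivative_partial_x:
  assumes "has_partial_x f" "x \<ge> 0" "y \<ge> 0"
  shows "((\<lambda>s. f (s, y)) has_field_derivative partial_x f (x, y)) (at x within {0..})"
  using assms
  by (simp add: has_partial_x_def partial_x_def quadrant_def
      has_real_derivative_iff_has_vector_derivative flip: vector_derivative_works)

lemma has_field_derivative_partial_y:
  assumes "has_partial_y f" "x \<ge> 0" "y \<ge> 0"
  shows "((\<lambda>t. f (x, t)) has_field_derivative partial_y f (x, y)) (at y within {0..})"
  using assms
  by (simp add: has_partial_y_def partial_y_def quadrant_def
      has_real_derivative_iff_has_vector_derivative flip: vector_derivative_works)

lemma C_space_box:
  assumes "f \<in> C_space N1 N2" "x \<ge> 0" "y \<ge> 0" "e > 0"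
  obtains d where "d > 0"
    "\<And>s t. s \<ge> 0 \<Longrightarrow> t \<ge> 0 \<Longrightarrow> \<bar>s - x\<bar> < d \<Longrightarrow> \<bar>t - y\<bar> < d \<Longrightarrow> \<bar>f (s, t) - f (x, y)\<bar> \<le> e"
proof -
  have "continuous_on quadrant f" using assms(1) by (simp add: C_space_def)
  moreover have "(x, y) \<in> quadrant" using assms(2,3) by (simp add: quadrant_def)
  ultimately obtain d where d: "d > 0"
    "\<And>p. p \<in> quadrant \<Longrightarrow> dist p (x, y) < d \<Longrightarrow> dist (f p) (f (x, y)) < e"
    using \<open>e > 0\<close> unfolding continuous_on_iff by blast
  \<comment> \<open>Half the radius suffices because the Euclidean distance is at most the sum of
    the two coordinate distances.\<close>
  show ?thesis
  proof (rule that[of "d / 2"])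
    fix s t assume st: "s \<ge> 0" "t \<ge> 0" "\<bar>s - x\<bar> < d / 2" "\<bar>t - y\<bar> < d / 2"
    have "dist (s, t) (x, y) \<le> \<bar>s - x\<bar> + \<bar>t - y\<bar>"
      using sqrt_sum_squares_le_sum_abs[of "s - x" "t - y"] by (simp add: dist_Pair_Pair dist_real_def)
    with st d(2)[of "(s, t)"] show "\<bar>f (s, t) - f (x, y)\<bar> \<le> e"
      by (simp add: quadrant_def dist_real_def)
  qed (use d in simp)
qed

text \<open>
  Only one of the two mixed partial derivatives appears: expanding first in \<open>s\<close>, then in \<open>t\<close>, makes
  their equality irrelevant.
\<close>

definition taylor2 :: "(real \<times> real \<Rightarrow> real) \<Rightarrow> real \<Rightarrow> real \<Rightarrow> real \<Rightarrow> real \<Rightarrow> real" where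
  "taylor2 f x y s t = f (x, y) + partial_x f (x, y) * (s - x) + partial_y f (x, y) * (t - y)
     + partial_x (partial_x f) (x, y) / 2 * (s - x)\<^sup>2
     + partial_y (partial_x f) (x, y) * ((s - x) * (t - y))
     + partial_y (partial_y f) (x, y) / 2 * (t - y)\<^sup>2"

text \<open>The path runs from \<open>(x, y)\<close> to \<open>(x, t)\<close> and on to
  \<open>(s, t)\<close>. Three errors arise: the remainder on each leg, and the change of
  \<open>partial_x f\<close> along the first leg, multiplied by \<open>s - x\<close>.\<close>

lemma taylor2_local:
  assumes f: "f \<in> C2_space N1 N2" and xy: "x \<ge> 0" "y \<ge> 0" and "e > 0"
  obtains d where "d > 0"
    "\<And>s t. s \<ge> 0 \<Longrightarrow> t \<ge> 0 \<Longrightarrow> \<bar>s - x\<bar> < d \<Longrightarrow> \<bar>t - y\<bar> < d \<Longrightarrow>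
       \<bar>f (s, t) - taylor2 f x y s t\<bar> \<le> e * ((s - x)\<^sup>2 + (t - y)\<^sup>2)"
proof -
  let ?fx = "partial_x f" and ?fy = "partial_y f"
  let ?fxx = "partial_x (partial_x f)" and ?fxy = "partial_y (partial_x f)"
    and ?fyy = "partial_y (partial_y f)"
  \<comment> \<open>With tolerance \<open>e / 2\<close>, the errors below add up to
    \<open>3 * e / 4\<close> times the squared distance.\<close>
  have e: "e / 2 > 0" using \<open>e > 0\<close> by simp
  have C: "?fxx \<in> C_space N1 N2" "?fxy \<in> C_space N1 N2" "?fyy \<in> C_space N1 N2"
    and P: "has_partial_x f" "has_partial_y f" "has_partial_x ?fx" "has_partial_y ?fx"
      "has_partial_y ?fy"
    using f by (auto simp: C2_space_def)
  obtain d1 where d1: "d1 > 0" "\<And>s t. s \<ge> 0 \<Longrightarrow> t \<ge> 0 \<Longrightarrow> \<bar>s - x\<bar> < d1 \<Longrightarrow> \<bar>t - y\<bar> < d1 \<Longrightarrow>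
      \<bar>?fxx (s, t) - ?fxx (x, y)\<bar> \<le> e / 2"
    using C_space_box[OF C(1) xy e] by metis
  obtain d2 where d2: "d2 > 0" "\<And>s t. s \<ge> 0 \<Longrightarrow> t \<ge> 0 \<Longrightarrow> \<bar>s - x\<bar> < d2 \<Longrightarrow> \<bar>t - y\<bar> < d2 \<Longrightarrow>
      \<bar>?fxy (s, t) - ?fxy (x, y)\<bar> \<le> e / 2"
    using C_space_box[OF C(2) xy e] by metis
  obtain d3 where d3: "d3 > 0" "\<And>s t. s \<ge> 0 \<Longrightarrow> t \<ge> 0 \<Longrightarrow> \<bar>s - x\<bar> < d3 \<Longrightarrow> \<bar>t - y\<bar> < d3 \<Longrightarrow>
      \<bar>?fyy (s, t) - ?fyy (x, y)\<bar> \<le> e / 2"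
    using C_space_box[OF C(3) xy e] by metis
  define d where "d = min d1 (min d2 d3)"
  show ?thesis
  proof (rule that)
    show "d > 0" using d1 d2 d3 by (simp add: d_def)
    fix s t assume st: "s \<ge> 0" "t \<ge> 0" "\<bar>s - x\<bar> < d" "\<bar>t - y\<bar> < d"
    have seg: "u \<ge> 0 \<and> \<bar>u - z\<bar> \<le> \<bar>v - z\<bar>" if "u \<in> closed_segment z v" "z \<ge> 0" "v \<ge> 0" for u v z :: real
      using that by (auto simp: closed_segment_eq_real_ivl split: if_splits)
    \<comment> \<open>The leg lies at height \<open>t\<close>, but \<open>c\<close> is the value of
      \<open>?fxx\<close> at \<open>(x, y)\<close>; the whole leg stays in the box where the two are
      close.\<close>
    have 1: "\<bar>f (s, t) - f (x, t) - ?fx (x, t) * (s - x) - ?fxx (x, y) / 2 * (s - x)\<^sup>2\<bar>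
        \<le> e / 2 * (s - x)\<^sup>2"
    proof (rule second_order_remainder[where S = "{0..}" and g'' = "\<lambda>u. ?fxx (u, t)"])
      fix u assume "u \<in> closed_segment x s"
      from seg[OF this] st xy show "\<bar>?fxx (u, t) - ?fxx (x, y)\<bar> \<le> e / 2"
        by (intro d1) (auto simp: d_def)
    qed (use st xy P in \<open>auto intro: has_field_derivative_partial_x\<close>)
    have 2: "\<bar>f (x, t) - f (x, y) - ?fy (x, y) * (t - y) - ?fyy (x, y) / 2 * (t - y)\<^sup>2\<bar>
        \<le> e / 2 * (t - y)\<^sup>2"
    proof (rule second_order_remainder[where S = "{0..}" and g'' = "\<lambda>u. ?fyy (x, u)"])
      fix u assume "u \<in> closed_segment y t"
      from seg[OF this] st xy d3(1) show "\<bar>?fyy (x, u) - ?fyy (x, y)\<bar> \<le> e / 2"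
        by (intro d3) (auto simp: d_def)
    qed (use st xy P in \<open>auto intro: has_field_derivative_partial_y\<close>)
    have "norm ((?fx (x, t) - ?fxy (x, y) * t) - (?fx (x, y) - ?fxy (x, y) * y)) \<le> e / 2 * norm (t - y)"
    proof (rule field_differentiable_bound[where S = "closed_segment y t"
          and f' = "\<lambda>u. ?fxy (x, u) - ?fxy (x, y)"])
      fix u assume u: "u \<in> closed_segment y t"
      note u' = seg[OF this xy(2) st(2)]
      from u' st xy d2(1) show "norm (?fxy (x, u) - ?fxy (x, y)) \<le> e / 2"
        unfolding real_norm_def by (intro d2) (auto simp: d_def)
      have "((\<lambda>t. ?fx (x, t)) has_field_derivative ?fxy (x, u)) (at u within {0..})"
        using u' xy P by (intro has_field_derivative_partial_y) auto
      then have "((\<lambda>t. ?fx (x, t)) has_field_derivative ?fxy (x, u)) (at u within closed_segment y t)"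
        using seg xy st by (elim has_field_derivative_subset) auto
      then show "((\<lambda>t. ?fx (x, t) - ?fxy (x, y) * t) has_field_derivative
          ?fxy (x, u) - ?fxy (x, y)) (at u within closed_segment y t)"
        by (auto intro!: derivative_eq_intros)
    qed auto
    then have "\<bar>?fx (x, t) - ?fx (x, y) - ?fxy (x, y) * (t - y)\<bar> * \<bar>s - x\<bar> \<le> e / 2 * \<bar>t - y\<bar> * \<bar>s - x\<bar>"
      by (intro mult_right_mono) (auto simp: algebra_simps)
    also have "\<dots> = e / 2 * (\<bar>t - y\<bar> * \<bar>s - x\<bar>)" by simp
    \<comment> \<open>The mixed error is split into squares by the arithmetic-geometric mean
      inequality.\<close>
    also have "\<bar>t - y\<bar> * \<bar>s - x\<bar> \<le> ((s - x)\<^sup>2 + (t - y)\<^sup>2) / 2"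
      using zero_le_power2[of "\<bar>t - y\<bar> - \<bar>s - x\<bar>"] by (simp add: power2_diff)
    finally have 3: "\<bar>(?fx (x, t) - ?fx (x, y) - ?fxy (x, y) * (t - y)) * (s - x)\<bar>
        \<le> e / 4 * ((s - x)\<^sup>2 + (t - y)\<^sup>2)"
      using \<open>e > 0\<close> by (simp add: abs_mult)
    have "f (s, t) - taylor2 f x y s t =
        (f (s, t) - f (x, t) - ?fx (x, t) * (s - x) - ?fxx (x, y) / 2 * (s - x)\<^sup>2)
      + (f (x, t) - f (x, y) - ?fy (x, y) * (t - y) - ?fyy (x, y) / 2 * (t - y)\<^sup>2)
      + (?fx (x, t) - ?fx (x, y) - ?fxy (x, y) * (t - y)) * (s - x)"
      by (simp add: taylor2_def algebra_simps)
    also have "\<bar>\<dots>\<bar> \<le> e / 2 * (s - x)\<^sup>2 + e / 2 * (t - y)\<^sup>2 + e / 4 * ((s - x)\<^sup>2 + (t - y)\<^sup>2)"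
      by (intro order_trans[OF abs_triangle_ineq] add_mono 1 2 3)
    also have "\<dots> \<le> e * ((s - x)\<^sup>2 + (t - y)\<^sup>2)"
    proof -
      have "0 \<le> e * ((s - x)\<^sup>2 + (t - y)\<^sup>2)" using \<open>e > 0\<close> by simp
      then show ?thesis by (simp add: algebra_simps)
    qed
    finally show "\<bar>f (s, t) - taylor2 f x y s t\<bar> \<le> e * ((s - x)\<^sup>2 + (t - y)\<^sup>2)" .
  qed
qed

lemma taylor2_exp_bound:
  assumes xy: "x \<ge> 0" "y \<ge> 0"
  obtains B where "B \<ge> 0" "\<And>s t. s \<ge> 0 \<Longrightarrow> t \<ge> 0 \<Longrightarrow> \<bar>taylor2 f x y s t\<bar> \<le> B * exp (s + t)"
proof -
  have lin: "\<bar>s - x\<bar> \<le> (1 + x) * exp s" if "s \<ge> 0" "x \<ge> 0" for s x :: real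
  proof -
    have "s \<le> exp s" "x * 1 \<le> x * exp s"
      using power_le_fact_exp[of s 1] mult_left_mono[of 1 "exp s" x] that by auto
    then show ?thesis using that by (simp add: distrib_right)
  qed
  have quad: "(s - x)\<^sup>2 \<le> (2 + x\<^sup>2) * exp s" if "s \<ge> 0" "x \<ge> 0" for s x :: real
  proof -
    have "s\<^sup>2 \<le> 2 * exp s" "x\<^sup>2 * 1 \<le> x\<^sup>2 * exp s" "0 \<le> 2 * s * x"
      using power_le_fact_exp[of s 2] mult_left_mono[of 1 "exp s" "x\<^sup>2"] that by auto
    then show ?thesis unfolding distrib_right power2_diff by linarith
  qed
  \<comment> \<open>Each increment of \<open>taylor2\<close> is replaced by its constant in a bound
    by a multiple of \<open>exp (s + t)\<close>.\<close>
  let ?B = "\<bar>f (x, y)\<bar> + \<bar>partial_x f (x, y)\<bar> * (1 + x) + \<bar>partial_y f (x, y)\<bar> * (1 + y)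
     + \<bar>partial_x (partial_x f) (x, y) / 2\<bar> * (2 + x\<^sup>2)
     + \<bar>partial_y (partial_x f) (x, y)\<bar> * ((1 + x) * (1 + y))
     + \<bar>partial_y (partial_y f) (x, y) / 2\<bar> * (2 + y\<^sup>2)"
  show ?thesis
  proof (rule that[of ?B])
    show "?B \<ge> 0" using xy by simp
    fix s t :: real assume st: "s \<ge> 0" "t \<ge> 0"
    let ?E = "exp (s + t)"
    have E: "1 \<le> ?E" "exp s \<le> ?E" "exp t \<le> ?E" using st by auto
    have "\<bar>s - x\<bar> \<le> (1 + x) * ?E"
      by (rule order_trans[OF lin]) (use st xy E in \<open>auto intro!: mult_left_mono\<close>)
    moreover have "\<bar>t - y\<bar> \<le> (1 + y) * ?E"
      by (rule order_trans[OF lin]) (use st xy E in \<open>auto intro!: mult_left_mono\<close>)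
    moreover have "(s - x)\<^sup>2 \<le> (2 + x\<^sup>2) * ?E"
      by (rule order_trans[OF quad]) (use st xy E in \<open>auto intro!: mult_left_mono\<close>)
    moreover have "(t - y)\<^sup>2 \<le> (2 + y\<^sup>2) * ?E"
      by (rule order_trans[OF quad]) (use st xy E in \<open>auto intro!: mult_left_mono\<close>)
    moreover have "\<bar>(s - x) * (t - y)\<bar> \<le> ((1 + x) * (1 + y)) * ?E"
      using mult_mono[OF lin[OF st(1) xy(1)] lin[OF st(2) xy(2)]] xy
      by (simp add: abs_mult exp_add mult_ac)
    ultimately have
      "\<bar>f (x, y)\<bar> + \<bar>partial_x f (x, y)\<bar> * \<bar>s - x\<bar> + \<bar>partial_y f (x, y)\<bar> * \<bar>t - y\<bar>
       + \<bar>partial_x (partial_x f) (x, y) / 2\<bar> * (s - x)\<^sup>2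
       + \<bar>partial_y (partial_x f) (x, y)\<bar> * \<bar>(s - x) * (t - y)\<bar>
       + \<bar>partial_y (partial_y f) (x, y) / 2\<bar> * (t - y)\<^sup>2
      \<le> \<bar>f (x, y)\<bar> * ?E + \<bar>partial_x f (x, y)\<bar> * ((1 + x) * ?E)
       + \<bar>partial_y f (x, y)\<bar> * ((1 + y) * ?E)
       + \<bar>partial_x (partial_x f) (x, y) / 2\<bar> * ((2 + x\<^sup>2) * ?E)
       + \<bar>partial_y (partial_x f) (x, y)\<bar> * (((1 + x) * (1 + y)) * ?E)
       + \<bar>partial_y (partial_y f) (x, y) / 2\<bar> * ((2 + y\<^sup>2) * ?E)"
    proof (intro add_mono mult_left_mono abs_ge_zero)
      show "\<bar>f (x, y)\<bar> \<le> \<bar>f (x, y)\<bar> * ?E"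
        using mult_left_mono[OF E(1), of "\<bar>f (x, y)\<bar>"] by simp
    qed
    also have "\<dots> = ?B * ?E" by (simp only: distrib_right mult.assoc)
    finally have "\<bar>f (x, y)\<bar> + \<bar>partial_x f (x, y) * (s - x)\<bar> + \<bar>partial_y f (x, y) * (t - y)\<bar>
       + \<bar>partial_x (partial_x f) (x, y) / 2 * (s - x)\<^sup>2\<bar>
       + \<bar>partial_y (partial_x f) (x, y) * ((s - x) * (t - y))\<bar>
       + \<bar>partial_y (partial_y f) (x, y) / 2 * (t - y)\<^sup>2\<bar> \<le> ?B * ?E"
      by (simp only: abs_mult abs_power2)
    then show "\<bar>taylor2 f x y s t\<bar> \<le> ?B * ?E"
      unfolding taylor2_def
      by (rule order_trans[rotated]) (intro order_trans[OF abs_triangle_ineq] add_mono order_refl)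
  qed
qed

text \<open>Outside the box some signed deviation is at least \<open>d\<close>, so
  \<open>exp (- (n * d))\<close> times the four exponentials is at least 1 there and dominates the
  indicator of the complement. As \<open>d\<close> and \<open>B\<close> are chosen before
  \<open>n\<close>, the tilt may later depend on \<open>m\<close>.\<close>

lemma taylor2_remainder:
  assumes f: "f \<in> C2_space N1 N2" and xy: "x \<ge> 0" "y \<ge> 0" and "e > 0"
  obtains d B where "d > 0" "B \<ge> 0"
    "\<And>s t n. s \<ge> 0 \<Longrightarrow> t \<ge> 0 \<Longrightarrow> n \<ge> 0 \<Longrightarrow>
       \<bar>f (s, t) - taylor2 f x y s t\<bar> \<le> e * ((s - x)\<^sup>2 + (t - y)\<^sup>2)
         + B * exp (- (n * d)) * ((exp (n * (s - x)) + exp (- n * (s - x))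
             + exp (n * (t - y)) + exp (- n * (t - y))) * exp (s + t))"
proof -
  obtain d where d: "d > 0"
    "\<And>s t. s \<ge> 0 \<Longrightarrow> t \<ge> 0 \<Longrightarrow> \<bar>s - x\<bar> < d \<Longrightarrow> \<bar>t - y\<bar> < d \<Longrightarrow>
       \<bar>f (s, t) - taylor2 f x y s t\<bar> \<le> e * ((s - x)\<^sup>2 + (t - y)\<^sup>2)"
    using taylor2_local[OF assms] by metis
  have "f \<in> C_space N1 N2" using f by (simp add: C2_space_def)
  then obtain B1 where B1: "B1 \<ge> 0" "\<And>s t. s \<ge> 0 \<Longrightarrow> t \<ge> 0 \<Longrightarrow> \<bar>f (s, t)\<bar> \<le> B1 * exp (s + t)"
    using C_space_exp_bound by metis
  obtain B2 where B2: "B2 \<ge> 0"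
    "\<And>s t. s \<ge> 0 \<Longrightarrow> t \<ge> 0 \<Longrightarrow> \<bar>taylor2 f x y s t\<bar> \<le> B2 * exp (s + t)"
    using taylor2_exp_bound[OF xy] by metis
  define B where "B = B1 + B2"
  show ?thesis
  proof (rule that)
    show "d > 0" "B \<ge> 0" using d B1 B2 by (auto simp: B_def)
    fix s t n :: real assume st: "s \<ge> 0" "t \<ge> 0" and n: "n \<ge> 0"
    let ?S = "exp (n * (s - x)) + exp (- n * (s - x)) + exp (n * (t - y)) + exp (- n * (t - y))"
    let ?R = "\<bar>f (s, t) - taylor2 f x y s t\<bar>"
    have sq: "0 \<le> e * ((s - x)\<^sup>2 + (t - y)\<^sup>2)" using \<open>e > 0\<close> by simp
    have tail: "0 \<le> B * exp (- (n * d)) * (?S * exp (s + t))"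
      using \<open>B \<ge> 0\<close> by (simp add: add_nonneg_nonneg)
    show "?R \<le> e * ((s - x)\<^sup>2 + (t - y)\<^sup>2) + B * exp (- (n * d)) * (?S * exp (s + t))"
    proof (cases "\<bar>s - x\<bar> < d \<and> \<bar>t - y\<bar> < d")
      case True
      then show ?thesis using d(2)[OF st] tail by linarith
    next
      case False
      then have "d \<le> s - x \<or> d \<le> - (s - x) \<or> d \<le> t - y \<or> d \<le> - (t - y)"
        by linarith
      then have "n * d \<le> n * (s - x) \<or> n * d \<le> - n * (s - x) \<or> n * d \<le> n * (t - y) \<or> n * d \<le> - n * (t - y)"
        using mult_left_mono[OF _ n, of d "s - x"] mult_left_mono[OF _ n, of d "- (s - x)"]
          mult_left_mono[OF _ n, of d "t - y"] mult_left_mono[OF _ n, of d "- (t - y)"]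
        unfolding minus_mult_commute by blast
      then have "exp (n * d) \<le> exp (n * (s - x)) \<or> exp (n * d) \<le> exp (- n * (s - x))
          \<or> exp (n * d) \<le> exp (n * (t - y)) \<or> exp (n * d) \<le> exp (- n * (t - y))"
        by (simp only: exp_le_cancel_iff)
      then have "exp (n * d) \<le> ?S"
        using exp_gt_zero[of "n * (s - x)"] exp_gt_zero[of "- n * (s - x)"]
          exp_gt_zero[of "n * (t - y)"] exp_gt_zero[of "- n * (t - y)"] by linarith
      then have "exp (- (n * d)) * exp (n * d) \<le> exp (- (n * d)) * ?S"
        by (intro mult_left_mono) auto
      then have "1 \<le> exp (- (n * d)) * ?S" by (simp flip: exp_add)
      moreover have "0 \<le> B * exp (s + t)" using \<open>B \<ge> 0\<close> by simp
      ultimately have "B * exp (s + t) * 1 \<le> B * exp (s + t) * (exp (- (n * d)) * ?S)"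
        by (intro mult_left_mono)
      also have "\<dots> = B * exp (- (n * d)) * (?S * exp (s + t))" by (simp only: mult_ac)
      finally have "B * exp (s + t) \<le> B * exp (- (n * d)) * (?S * exp (s + t))" by simp
      moreover have "?R \<le> B * exp (s + t)"
        using B1(2)[OF st] B2(2)[OF st] unfolding B_def distrib_right by linarith
      ultimately show ?thesis using sq by linarith
    qed
  qed
qed

subsection \<open>The limit\<close>

lemma tilted_mgf_has_sum:
  assumes "r \<ge> 0"
  shows "((\<lambda>k. poisson_weight r k * (exp (n * (real k / real m - x)) * exp (real k / real m)))
           has_sum tilted_mgf m r x n) UNIV"
proof -
  have "exp (n * (u - x)) * exp u = exp (- (n * x)) * exp ((1 + n) * u)" for u
    by (simp add: algebra_simps flip: exp_add)
  then show ?thesis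
    using has_sum_cmult_right[OF poisson_mgf[OF assms, of "1 + n" m], of "exp (- (n * x))"]
    by (simp add: tilted_mgf_def mult_ac)
qed

definition taylor2_mean :: "(real \<times> real \<Rightarrow> real) \<Rightarrow> real \<Rightarrow> real \<Rightarrow> nat \<Rightarrow> real \<Rightarrow> real \<Rightarrow> real" where
  "taylor2_mean f x y m r q =
     f (x, y) + partial_x f (x, y) * (r / real m - x) + partial_y f (x, y) * (q / real m - y)
     + partial_x (partial_x f) (x, y) / 2 * (r / (real m)\<^sup>2 + (r / real m - x)\<^sup>2)
     + partial_y (partial_x f) (x, y) * ((r / real m - x) * (q / real m - y))
     + partial_y (partial_y f) (x, y) / 2 * (q / (real m)\<^sup>2 + (q / real m - y)\<^sup>2)"

text \<open>By independence the mean of the mixed term is the product of the two biases; each square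
  contributes variance plus squared bias.\<close>

lemma poisson2_mean_taylor2:
  assumes "r \<ge> 0" "q \<ge> 0"
  shows "poisson2_mean m r q (taylor2 f x y) (taylor2_mean f x y m r q)"
  unfolding taylor2_def [abs_def] taylor2_mean_def
  by (intro poisson2_mean_add poisson2_mean_cmult poisson2_mean_const
      poisson2_mean_product[where g = "\<lambda>s. s - x" and h = "\<lambda>t. t - y"]
      poisson2_mean_fst[where g = "\<lambda>s. s - x"] poisson2_mean_snd[where h = "\<lambda>t. t - y"]
      poisson2_mean_fst[where g = "\<lambda>s. (s - x)\<^sup>2"] poisson2_mean_snd[where h = "\<lambda>t. (t - y)\<^sup>2"]
      poisson_mean_deviation poisson_mean_square_deviation assms)

text \<open>The mean of the pointwise bound in \<open>taylor2_remainder\<close>. Only one coordinate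
  is tilted at a time; the other keeps its growth factor and appears with tilt 0.\<close>

lemma Y_hat_taylor2_mean:
  assumes f: "f \<in> C2_space N1 N2" and xy: "x \<ge> 0" "y \<ge> 0" and "e > 0" and "a > 1"
  obtains d B where "d > 0" "B \<ge> 0"
    "\<And>m n. n \<ge> 0 \<Longrightarrow>
       \<bar>Y_hat m m a f (x, y) - taylor2_mean f x y m (x * rate a m) (y * rate a m)\<bar> \<le>
       e * ((x * rate a m / (real m)\<^sup>2 + (x * rate a m / real m - x)\<^sup>2)
          + (y * rate a m / (real m)\<^sup>2 + (y * rate a m / real m - y)\<^sup>2))
       + B * exp (- (n * d)) *
         (tilted_mgf m (x * rate a m) x n * tilted_mgf m (y * rate a m) y 0
          + tilted_mgf m (x * rate a m) x (- n) * tilted_mgf m (y * rate a m) y 0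
          + tilted_mgf m (x * rate a m) x 0 * tilted_mgf m (y * rate a m) y n
          + tilted_mgf m (x * rate a m) x 0 * tilted_mgf m (y * rate a m) y (- n))"
proof -
  obtain d B where dB: "d > 0" "B \<ge> 0"
    "\<And>s t n. s \<ge> 0 \<Longrightarrow> t \<ge> 0 \<Longrightarrow> n \<ge> 0 \<Longrightarrow>
       \<bar>f (s, t) - taylor2 f x y s t\<bar> \<le> e * ((s - x)\<^sup>2 + (t - y)\<^sup>2)
         + B * exp (- (n * d)) * ((exp (n * (s - x)) + exp (- n * (s - x))
             + exp (n * (t - y)) + exp (- n * (t - y))) * exp (s + t))"
    using taylor2_remainder[OF assms(1-4)] by metis
  have "f \<in> C_space N1 N2" using f by (simp add: C2_space_def)
  then obtain B' where B': "\<And>s t. s \<ge> 0 \<Longrightarrow> t \<ge> 0 \<Longrightarrow> \<bar>f (s, t)\<bar> \<le> B' * exp (s + t)"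
    using C_space_exp_bound by metis
  show ?thesis
  proof (rule that[OF dB(1,2)])
    fix m :: nat and n :: real
    assume n: "n \<ge> 0"
    \<comment> \<open>This includes \<open>m = 0\<close>, where division by zero makes the rate
      0.\<close>
    have "rate a m \<ge> 0" unfolding rate_def using \<open>a > 1\<close> by (simp add: ge_one_powr_ge_zero)
    define r q where "r = x * rate a m" and "q = y * rate a m"
    have rq: "r \<ge> 0" "q \<ge> 0" using \<open>rate a m \<ge> 0\<close> xy by (auto simp: r_def q_def)
    have tilt: "poisson2_mean m r q
        (\<lambda>s t. (exp (k * (s - x)) * exp s) * (exp (l * (t - y)) * exp t))
        (tilted_mgf m r x k * tilted_mgf m q y l)" for k l
      by (intro poisson2_mean_product[where g = "\<lambda>s. exp (k * (s - x)) * exp s"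
            and h = "\<lambda>t. exp (l * (t - y)) * exp t"] tilted_mgf_has_sum rq)
    \<comment> \<open>The remainder bound with \<open>exp (s + t)\<close> split between the
      coordinates and trivial factors \<open>exp 0\<close> inserted, so that every summand is an
      instance of \<open>tilt\<close>.\<close>
    let ?K = "\<lambda>s t. e * ((s - x)\<^sup>2 + (t - y)\<^sup>2) + B * exp (- (n * d)) *
       ((exp (n * (s - x)) * exp s) * (exp (0 * (t - y)) * exp t)
        + (exp (- n * (s - x)) * exp s) * (exp (0 * (t - y)) * exp t)
        + (exp (0 * (s - x)) * exp s) * (exp (n * (t - y)) * exp t)
        + (exp (0 * (s - x)) * exp s) * (exp (- n * (t - y)) * exp t))"
    let ?E = "e * ((r / (real m)\<^sup>2 + (r / real m - x)\<^sup>2) + (q / (real m)\<^sup>2 + (q / real m - y)\<^sup>2))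
       + B * exp (- (n * d)) *
         (tilted_mgf m r x n * tilted_mgf m q y 0 + tilted_mgf m r x (- n) * tilted_mgf m q y 0
          + tilted_mgf m r x 0 * tilted_mgf m q y n + tilted_mgf m r x 0 * tilted_mgf m q y (- n))"
    have K: "poisson2_mean m r q ?K ?E"
      by (intro poisson2_mean_add poisson2_mean_cmult tilt
          poisson2_mean_fst[where g = "\<lambda>s. (s - x)\<^sup>2"] poisson2_mean_snd[where h = "\<lambda>t. (t - y)\<^sup>2"]
          poisson_mean_square_deviation rq)
    have "poisson2_mean m r q
        (\<lambda>s t. B' * ((exp (0 * (s - x)) * exp s) * (exp (0 * (t - y)) * exp t)))
        (B' * (tilted_mgf m r x 0 * tilted_mgf m q y 0))"
      by (intro poisson2_mean_cmult tilt)
    then have "\<exists>E. poisson2_mean m r q (\<lambda>s t. f (s, t)) E"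
      by (rule poisson2_mean_dominated[OF rq]) (use B' in \<open>simp add: exp_add\<close>)
    then obtain E where E: "poisson2_mean m r q (\<lambda>s t. f (s, t)) E" ..
    have "\<bar>E - taylor2_mean f x y m r q\<bar> \<le> ?E"
    proof (rule poisson2_mean_abs_diff_le[OF rq E poisson2_mean_taylor2[OF rq] K])
      fix s t :: real assume "s \<ge> 0" "t \<ge> 0"
      from dB(3)[OF this n] show "\<bar>f (s, t) - taylor2 f x y s t\<bar> \<le> ?K s t"
        by (simp add: exp_add algebra_simps)
    qed
    moreover have "Y_hat m m a f (x, y) = E"
      using Y_hat_eq_poisson2_mean[OF \<open>a > 1\<close>] E by (simp add: r_def q_def)
    ultimately show "\<bar>Y_hat m m a f (x, y) - taylor2_mean f x y m (x * rate a m) (y * rate a m)\<bar> \<le>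
       e * ((x * rate a m / (real m)\<^sup>2 + (x * rate a m / real m - x)\<^sup>2)
          + (y * rate a m / (real m)\<^sup>2 + (y * rate a m / real m - y)\<^sup>2))
       + B * exp (- (n * d)) *
         (tilted_mgf m (x * rate a m) x n * tilted_mgf m (y * rate a m) y 0
          + tilted_mgf m (x * rate a m) x (- n) * tilted_mgf m (y * rate a m) y 0
          + tilted_mgf m (x * rate a m) x 0 * tilted_mgf m (y * rate a m) y n
          + tilted_mgf m (x * rate a m) x 0 * tilted_mgf m (y * rate a m) y (- n))"
      by (simp add: r_def q_def)
  qed
qed

lemma taylor2_mean_tendsto:
  assumes "a > 1"
  shows "(\<lambda>m. real m * (taylor2_mean f x y m (x * rate a m) (y * rate a m) - f (x, y))) \<longlonglongrightarrow>
     - (x * ln a / 2) * partial_x f (x, y) - (y * ln a / 2) * partial_y f (x, y)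
     + (x / 2) * partial_x (partial_x f) (x, y) + (y / 2) * partial_y (partial_y f) (x, y)"
proof -
  let ?dev = "\<lambda>z m. real m * (z * rate a m / real m - z)"
  let ?sq = "\<lambda>z m. real m * (z * rate a m / (real m)\<^sup>2 + (z * rate a m / real m - z)\<^sup>2)"
  have "(\<lambda>m. partial_x f (x, y) * ?dev x m + partial_y f (x, y) * ?dev y m
     + partial_x (partial_x f) (x, y) / 2 * ?sq x m
     + partial_y (partial_x f) (x, y) * (?dev x m * (y * (rate a m / real m) - y))
     + partial_y (partial_y f) (x, y) / 2 * ?sq y m) \<longlonglongrightarrow>
     partial_x f (x, y) * - (x * ln a / 2) + partial_y f (x, y) * - (y * ln a / 2)
     + partial_x (partial_x f) (x, y) / 2 * x
     + partial_y (partial_x f) (x, y) * (- (x * ln a / 2) * (y * 1 - y))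
     + partial_y (partial_y f) (x, y) / 2 * y"
    by (intro tendsto_add tendsto_mult tendsto_diff tendsto_const rate_div_tendsto
        rate_deviation_tendsto rate_square_deviation_tendsto assms)
  then show ?thesis
    by (simp add: taylor2_mean_def distrib_left mult_ac add.assoc)
qed

theorem theorem4p1:
  fixes a x y :: real and N1 N2 :: nat and f :: "real \<times> real \<Rightarrow> real"
  assumes "a > 1"
    and "f \<in> C2_space N1 N2"
    and "(x, y) \<in> quadrant"
  shows "(\<lambda>m. real m * (Y_hat m m a f (x, y) - f (x, y))) \<longlonglongrightarrow>
           - (x * ln a / 2) * partial_x f (x, y)
           - (y * ln a / 2) * partial_y f (x, y)
           + (x / 2) * partial_x (partial_x f) (x, y)
           + (y / 2) * partial_y (partial_y f) (x, y)"
proof -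
  have xy: "x \<ge> 0" "y \<ge> 0" using assms(3) by (auto simp: quadrant_def)
  let ?T = "\<lambda>m. taylor2_mean f x y m (x * rate a m) (y * rate a m)"
  let ?D = "\<lambda>m. real m * (Y_hat m m a f (x, y) - ?T m)"
  have "?D \<longlonglongrightarrow> 0"
  proof (rule tendstoI)
    fix \<eta> :: real assume "\<eta> > 0"
    \<comment> \<open>The scaled mean squares tend to \<open>x + y\<close>, so this choice leaves at
      most \<open>\<eta> / 2\<close> in the limit; the added 1 keeps the denominator positive at the
      origin.\<close>
    define e where "e = \<eta> / (2 * (x + y + 1))"
    have "e > 0" using \<open>\<eta> > 0\<close> xy by (simp add: e_def)
    let ?sq = "\<lambda>z m. z * rate a m / (real m)\<^sup>2 + (z * rate a m / real m - z)\<^sup>2"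
    let ?M = "\<lambda>z m n. tilted_mgf m (z * rate a m) z n"
    let ?S = "\<lambda>m n. ?M x m n * ?M y m 0 + ?M x m (- n) * ?M y m 0
        + ?M x m 0 * ?M y m n + ?M x m 0 * ?M y m (- n)"
    obtain d B where dB: "d > 0" "B \<ge> 0"
      "\<And>m n. n \<ge> 0 \<Longrightarrow> \<bar>Y_hat m m a f (x, y) - ?T m\<bar> \<le>
         e * (?sq x m + ?sq y m) + B * exp (- (n * d)) * ?S m n"
      using Y_hat_taylor2_mean[OF assms(2) xy \<open>e > 0\<close> assms(1)] by metis
    \<comment> \<open>The error bound with tilt \<open>n = sqrt m\<close>, multiplied by
      \<open>m\<close>: the tilted moments stay bounded while
      \<open>m * exp (- (sqrt m * d))\<close> vanishes.\<close>
    let ?U = "\<lambda>m. e * (real m * ?sq x m + real m * ?sq y m)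
        + B * (real m * exp (- (sqrt (real m) * d))) * ?S m (sqrt (real m))"
    have "?U \<longlonglongrightarrow> e * (x + y) + B * 0 *
        (exp (x * (3 / 2)) * exp (y * 1) + exp (x * (3 / 2)) * exp (y * 1)
         + exp (x * 1) * exp (y * (3 / 2)) + exp (x * 1) * exp (y * (3 / 2)))"
      by (intro tendsto_add tendsto_mult tendsto_const rate_square_deviation_tendsto
          tilted_mgf_tendsto mult_exp_minus_sqrt_tendsto assms dB)
    moreover have "e * (x + y) < \<eta>"
      using \<open>\<eta> > 0\<close> xy by (simp add: e_def divide_simps)
    ultimately have "\<forall>\<^sub>F m in sequentially. ?U m < \<eta>"
      by (auto dest: order_tendstoD(2))
    then show "\<forall>\<^sub>F m in sequentially. dist (?D m) 0 < \<eta>"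
    proof eventually_elim
      case (elim m)
      have "\<bar>?D m\<bar> = real m * \<bar>Y_hat m m a f (x, y) - ?T m\<bar>"
        by (simp add: abs_mult)
      also have "\<dots> \<le> real m * (e * (?sq x m + ?sq y m)
          + B * exp (- (sqrt (real m) * d)) * ?S m (sqrt (real m)))"
        by (intro mult_left_mono dB) auto
      also have "\<dots> = ?U m" by (simp only: distrib_left mult_ac)
      finally show ?case using elim by (simp only: dist_real_def diff_zero)
    qed
  qed
  from tendsto_add[OF this taylor2_mean_tendsto[OF assms(1), of f x y]]
  show ?thesis
    by (simp only: add_0_left flip: distrib_left) simp
qed

end
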